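(* Let $g$ be an element of $C[0,1]$ outside the closed unit ball $\overline{B_{C[0,1]}}$. Then $g$ can be separated from $\overline{B_{C[0,1]}}$ by an $H$-invariant continuous polynomial $P$ if and only if $\max\{|g(0)|,|g(1)|\}>1$.
   Context: $C[0,1]$ is the Banach space of complex-valued continuous functions on $[0,1]$ with the supremum norm. $H$ is the group of composition operators $\gamma:C[0,1]\to C[0,1]$ of the form $\gamma(f)=f\circ\phi$ for some homeomorphism $\phi:[0,1]\to[0,1]$. A (complex-valued) polynomial $P$ on $C[0,1]$ is $H$-invariant if $P\circ\gamma=P$ for every $\gamma\in H$. A polynomial $P$ separates a point $g$ and a set $B$ if $\sup_{f\in B}|P(f)|<|P(g)|$. *)

theory Defs
  imports "HOL-Analysis.Analysis"
begin

section \<open>The unit interval as a compact metric space\<close>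

typedef unit_interval = "{0..1::real}"
  morphisms coord unit_point
  by auto

setup_lifting type_definition_unit_interval

instantiation unit_interval :: "{zero, one}"
begin

lift_definition zero_unit_interval :: unit_interval is "0::real" by simp

lift_definition one_unit_interval :: unit_interval is "1::real" by simp

instance ..

end

instantiation unit_interval :: metric_space
begin

definition dist_unit_interval :: "unit_interval \<Rightarrow> unit_interval \<Rightarrow> real" where
  "dist_unit_interval s t = dist (coord s) (coord t)"

definition uniformity_unit_interval :: "(unit_interval \<times> unit_interval) filter" where
  "uniformity_unit_interval = (INF e\<in>{0 <..}. principal {(x, y). dist x y < e})"

definition open_unit_interval :: "unit_interval set \<Rightarrow> bool" where
  "open_unit_interval U = (\<forall>x\<in>U. \<forall>\<^sub>F (x', y) in uniformity. x' = x \<longrightarrow> y \<in> U)"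

instance
proof
  fix x y z :: unit_interval
  show "dist x y = 0 \<longleftrightarrow> x = y"
    by (simp add: dist_unit_interval_def coord_inject)
  show "dist x y \<le> dist x z + dist y z"
    unfolding dist_unit_interval_def by (rule dist_triangle2)
qed (rule uniformity_unit_interval_def open_unit_interval_def)+

end

lemma homeomorphism_coord: "homeomorphism UNIV {0..1} coord unit_point"
proof (rule homeomorphismI)
  show "continuous_on UNIV coord"
    by (auto simp: continuous_on_iff dist_unit_interval_def)
  show "continuous_on {0..1} unit_point"
    by (auto simp: continuous_on_iff dist_unit_interval_def unit_point_inverse)
  show "coord ` UNIV \<subseteq> {0..1}" "unit_point ` {0..1} \<subseteq> UNIV"
    using coord by auto
qed (auto simp: coord_inverse unit_point_inverse)

lemma compact_UNIV_unit_interval: "compact (UNIV :: unit_interval set)"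
  using homeomorphism_coord homeomorphic_compactness homeomorphic_def by blast

section \<open>The complex Banach space \<open>C[0,1]\<close>\<close>

text \<open>
  Since the unit interval is compact, its bounded continuous functions are all its
  continuous functions; the two lemmas below record the correspondence with functions on
  \<open>{0..1}\<close> and that the norm is the supremum norm.
\<close>

type_synonym C01 = "unit_interval \<Rightarrow>\<^sub>C complex"

lemma C01_of_continuous_on:
  assumes "continuous_on {0..1} f"
  shows "\<exists>!F::C01. \<forall>t. F t = f (coord t)"
proof -
  have "continuous_on UNIV (f \<circ> coord)"
    using assms homeomorphism_coord
    by (intro continuous_on_compose) (auto simp: homeomorphism_def)
  moreover from this have "bounded (range (f \<circ> coord))"
    using compact_UNIV_unit_interval compact_continuous_image compact_imp_bounded by blast
  ultimately have "f \<circ> coord \<in> bcontfun"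
    by (simp add: bcontfun_def)
  then obtain F :: C01 where "f \<circ> coord = apply_bcontfun F"
    by (rule bcontfunE)
  then have F: "\<forall>t. F t = f (coord t)"
    by (metis comp_apply)
  show ?thesis
  proof (rule ex1I)
    show "\<forall>t. F t = f (coord t)" by (rule F)
  next
    fix G :: C01
    assume "\<forall>t. G t = f (coord t)"
    with F show "G = F"
      by (intro bcontfun_eqI) simp
  qed
qed

lemma norm_C01: "norm (f::C01) = (SUP t. cmod (f t))"
  by (simp add: norm_bcontfun_def dist_bcontfun.rep_eq)

text \<open>
  The library type carries only the real vector space structure; polynomials need
  multiplication by complex scalars.
\<close>

setup_lifting type_definition_bcontfun

lift_definition scaleC :: "complex \<Rightarrow> C01 \<Rightarrow> C01"
  is "\<lambda>c (f :: unit_interval \<Rightarrow> complex) t. c * f t"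
proof -
  fix c :: complex and f :: "unit_interval \<Rightarrow> complex"
  assume f: "f \<in> bcontfun"
  have "bounded ((*) c ` range f)"
    using f by (intro bounded_linear_image[OF _ bounded_linear_mult_right])
      (simp add: bcontfun_def)
  then show "(\<lambda>t. c * f t) \<in> bcontfun"
    using f by (simp add: bcontfun_def image_image continuous_on_mult_left)
qed

lemma scaleC_of_real: "scaleC (of_real r) f = r *\<^sub>R f"
  by (rule bcontfun_eqI) (simp add: scaleC.rep_eq scaleR_conv_of_real)

section \<open>Polynomials on \<open>C[0,1]\<close>\<close>

text \<open>
  An \<open>m\<close>-linear form takes its arguments as a sequence, of which only the entries with
  index below \<open>m\<close> matter; for \<open>m = 0\<close> these are the constants.
\<close>

definition multilinear_form :: "nat \<Rightarrow> ((nat \<Rightarrow> C01) \<Rightarrow> complex) \<Rightarrow> bool" where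
  "multilinear_form m A \<longleftrightarrow>
     (\<forall>x y. (\<forall>i<m. x i = y i) \<longrightarrow> A x = A y) \<and>
     (\<forall>x. \<forall>i<m.
        (\<forall>u v. A (x(i := u + v)) = A (x(i := u)) + A (x(i := v))) \<and>
        (\<forall>c u. A (x(i := scaleC c u)) = c * A (x(i := u))))"

definition homogeneous_polynomial :: "nat \<Rightarrow> (C01 \<Rightarrow> complex) \<Rightarrow> bool" where
  "homogeneous_polynomial m P \<longleftrightarrow>
     (\<exists>A. multilinear_form m A \<and> (\<forall>f. P f = A (\<lambda>_. f)))"

definition polynomial :: "(C01 \<Rightarrow> complex) \<Rightarrow> bool" where
  "polynomial P \<longleftrightarrow>
     (\<exists>n Q. (\<forall>m\<le>n. homogeneous_polynomial m (Q m)) \<and> (\<forall>f. P f = (\<Sum>m\<le>n. Q m f)))"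

definition continuous_polynomial :: "(C01 \<Rightarrow> complex) \<Rightarrow> bool" where
  "continuous_polynomial P \<longleftrightarrow> polynomial P \<and> continuous_on UNIV P"

section \<open>Invariance and separation\<close>

definition H :: "(C01 \<Rightarrow> C01) set" where
  "H = {\<gamma>. \<exists>\<phi> \<psi>. homeomorphism UNIV UNIV \<phi> \<psi> \<and>
         (\<forall>f. apply_bcontfun (\<gamma> f) = apply_bcontfun f \<circ> \<phi>)}"

definition H_invariant :: "(C01 \<Rightarrow> complex) \<Rightarrow> bool" where
  "H_invariant P \<longleftrightarrow> (\<forall>\<gamma>\<in>H. P \<circ> \<gamma> = P)"

text \<open>
  The supremum is taken in the extended reals, so that it is infinite when \<open>P\<close> is
  unbounded on \<open>B\<close>.
\<close>

definition separates :: "(C01 \<Rightarrow> complex) \<Rightarrow> C01 \<Rightarrow> C01 set \<Rightarrow> bool" where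
  "separates P g B \<longleftrightarrow> (SUP f\<in>B. ereal (cmod (P f))) < ereal (cmod (P g))"

end

theory Submission
  imports Defs
begin

text \<open>
  An invariant continuous polynomial \<open>P\<close> takes the same value on \<open>f\<close> and on every monotone
  reparametrisation of the path \<open>f\<close>. Inserting a loop at an endpoint of a path does not change
  the value of \<open>P\<close> either: the value after \<open>m\<close> insertions is a polynomial in \<open>m\<close> which, for
  small loops, is bounded. So any two paths with the same endpoints can be joined through a
  common extension, and \<open>P f\<close> depends only on \<open>f 0\<close> and \<open>f 1\<close>; if both lie in the closed unit
  disc, the segment between them is a function in the ball with the same value of \<open>P\<close>.
  Conversely, \<open>f 0 * f 1\<close> separates \<open>g\<close> if \<open>|g 0 * g 1| > 1\<close>, and otherwise
  \<open>f 0 ^ n + f 1 ^ n\<close> does for large \<open>n\<close>.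
\<close>

section \<open>Finite differences\<close>

text \<open>Frechet's notion of a (generalised) polynomial of degree less than \<open>n\<close>. The
  successive steps are arbitrary and may differ; only addition enters, which suits both sums of
  several loops and points along a line.\<close>

primrec differences_vanish :: "nat \<Rightarrow> ('a::ab_group_add \<Rightarrow> complex) \<Rightarrow> bool" where
  "differences_vanish 0 P \<longleftrightarrow> (\<forall>f. P f = 0)"
| "differences_vanish (Suc n) P \<longleftrightarrow> (\<forall>d. differences_vanish n (\<lambda>f. P (f + d) - P f))"

lemma differences_vanish_zero [simp]: "differences_vanish n (\<lambda>f. 0)"
  by (induction n) auto

lemma differences_vanish_add:
  "differences_vanish n P \<Longrightarrow> differences_vanish n Q \<Longrightarrow> differences_vanish n (\<lambda>f. P f + Q f)"
proof (induction n arbitrary: P Q)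
  case (Suc n)
  have "differences_vanish n (\<lambda>f. (P (f + d) - P f) + (Q (f + d) - Q f))" for d
    using Suc by simp
  then show ?case by (simp add: algebra_simps)
qed simp

lemma differences_vanish_sum:
  "(\<And>i. i \<in> I \<Longrightarrow> differences_vanish n (P i)) \<Longrightarrow> differences_vanish n (\<lambda>f. \<Sum>i\<in>I. P i f)"
  by (induction I rule: infinite_finite_induct) (auto intro: differences_vanish_add)

lemma differences_vanish_Suc: "differences_vanish n P \<Longrightarrow> differences_vanish (Suc n) P"
proof (induction n arbitrary: P)
  case (Suc n)
  have "differences_vanish (Suc n) (\<lambda>f. P (f + d) - P f)" for d
    by (rule Suc.IH) (use Suc.prems in simp)
  then show ?case by (subst differences_vanish.simps(2)) blast
qed simp

lemma differences_vanish_mono: "m \<le> n \<Longrightarrow> differences_vanish m P \<Longrightarrow> differences_vanish n P"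
  by (induction n rule: dec_induct) (simp_all only: differences_vanish_Suc)

lemma differences_vanish_multilinear_form:
  assumes A: "multilinear_form m A" and T: "T \<subseteq> {..<m}"
  shows "differences_vanish (Suc (card T)) (\<lambda>f. A (\<lambda>i. if i \<in> T then f + e i else c i))"
  using T
proof (induction "card T" arbitrary: T e c)
  case 0
  then have "T = {}" using finite_subset by fastforce
  then show ?case by simp
next
  case (Suc k T e c)
  have finT: "finite T" using Suc.prems finite_subset by blast
  \<comment> \<open>The passage from \<open>f\<close> to \<open>f + d\<close> is made slot by slot;
    \<open>U\<close> collects the slots already shifted.\<close>
  have step: "differences_vanish (card T) (\<lambda>f. A (\<lambda>i. if i \<in> T then f + (if i \<in> U then e i + d else e i) else c i)
      - A (\<lambda>i. if i \<in> T then f + e i else c i))" if "finite U" "U \<subseteq> T" for U d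
    using that
  proof (induction U)
    case (insert j U)
    let ?e = "\<lambda>i. if i \<in> U then e i + d else e i"
    let ?x = "\<lambda>f i. if i \<in> T then f + ?e i else c i"
    have j: "j \<in> T" "j < m" "j \<notin> U" using insert Suc.prems by auto
    have "A (\<lambda>i. if i \<in> T then f + (if i \<in> insert j U then e i + d else e i) else c i)
        = A (?x f) + A (\<lambda>i. if i \<in> T - {j} then f + ?e i else (c(j := d)) i)" for f
    proof -
      have "A ((?x f)(j := (f + e j) + d)) = A ((?x f)(j := f + e j)) + A ((?x f)(j := d))"
        using A j unfolding multilinear_form_def by blast
      moreover have "(?x f)(j := (f + e j) + d)
          = (\<lambda>i. if i \<in> T then f + (if i \<in> insert j U then e i + d else e i) else c i)"
        using j by (auto simp: fun_eq_iff add.assoc)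
      moreover have "(?x f)(j := f + e j) = ?x f" using j by (auto simp: fun_eq_iff)
      moreover have "(?x f)(j := d) = (\<lambda>i. if i \<in> T - {j} then f + ?e i else (c(j := d)) i)"
        using j by (auto simp: fun_eq_iff)
      ultimately show ?thesis by simp
    qed
    then have eq: "(\<lambda>f. A (\<lambda>i. if i \<in> T then f + (if i \<in> insert j U then e i + d else e i) else c i)
           - A (\<lambda>i. if i \<in> T then f + e i else c i))
        = (\<lambda>f. (A (?x f) - A (\<lambda>i. if i \<in> T then f + e i else c i))
           + A (\<lambda>i. if i \<in> T - {j} then f + ?e i else (c(j := d)) i))"
      by (simp add: fun_eq_iff)
    have card: "k = card (T - {j})" using Suc.hyps(2) j finT by simp
    have "differences_vanish (Suc (card (T - {j}))) (\<lambda>f. A (\<lambda>i. if i \<in> T - {j} then f + ?e i else (c(j := d)) i))"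
      by (rule Suc.hyps(1)[OF card]) (use Suc.prems in auto)
    then have "differences_vanish (card T) (\<lambda>f. A (\<lambda>i. if i \<in> T - {j} then f + ?e i else (c(j := d)) i))"
      by (simp only: card[symmetric] Suc.hyps(2))
    with insert show ?case unfolding eq by (intro differences_vanish_add) auto
  qed (simp cong: if_cong)
  have "differences_vanish (card T) (\<lambda>f. A (\<lambda>i. if i \<in> T then (f + d) + e i else c i)
      - A (\<lambda>i. if i \<in> T then f + e i else c i))" for d
  proof -
    have "(\<lambda>i. if i \<in> T then (f + d) + e i else c i)
        = (\<lambda>i. if i \<in> T then f + (if i \<in> T then e i + d else e i) else c i)" for f
      by (auto simp: fun_eq_iff algebra_simps)
    then show ?thesis using step[OF finT subset_refl, of d] by simp
  qed
  then show ?case by simp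
qed

lemma differences_vanish_homogeneous_polynomial:
  assumes "homogeneous_polynomial m P"
  shows "differences_vanish (Suc m) P"
proof -
  obtain A where A: "multilinear_form m A" "\<And>f. P f = A (\<lambda>_. f)"
    using assms unfolding homogeneous_polynomial_def by blast
  have "A (\<lambda>_. f) = A (\<lambda>i. if i \<in> {..<m} then f + 0 else 0)" for f
  proof -
    have "\<forall>x y. (\<forall>i<m. x i = y i) \<longrightarrow> A x = A y"
      using A(1) unfolding multilinear_form_def by (rule conjunct1)
    from this[rule_format, of "\<lambda>_. f" "\<lambda>i. if i \<in> {..<m} then f + 0 else 0"]
    show ?thesis by simp
  qed
  then have eq: "(\<lambda>f. A (\<lambda>i. if i \<in> {..<m} then f + 0 else 0)) = P"
    by (intro ext) (simp only: A(2))
  show ?thesis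
    using differences_vanish_multilinear_form[OF A(1) subset_refl, of "\<lambda>_. 0" "\<lambda>_. 0"]
    by (simp only: eq card_lessThan)
qed

lemma differences_vanish_polynomial:
  assumes "polynomial P"
  obtains n where "differences_vanish (Suc n) P"
proof -
  obtain n Q where Q: "\<And>m. m \<le> n \<Longrightarrow> homogeneous_polynomial m (Q m)" and P: "\<And>f. P f = (\<Sum>m\<le>n. Q m f)"
    using assms unfolding polynomial_def by blast
  have "differences_vanish (Suc n) (\<lambda>f. \<Sum>m\<in>{..n}. Q m f)"
  proof (intro differences_vanish_sum)
    fix m assume "m \<in> {..n}"
    then show "differences_vanish (Suc n) (Q m)"
      by (intro differences_vanish_mono[OF _ differences_vanish_homogeneous_polynomial[OF Q]]) auto
  qed
  moreover have "(\<lambda>f. \<Sum>m\<in>{..n}. Q m f) = P" by (intro ext) (simp only: P)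
  ultimately show ?thesis using that by (simp only:)
qed

text \<open>The function \<open>q\<close> is a polynomial in the number of summands, so it can only be bounded if
  it is constant.\<close>

lemma bounded_differences_vanish_imp_constant:
  fixes d :: "'i \<Rightarrow> 'a::ab_group_add"
  assumes "differences_vanish n P" and "infinite I"
    and "\<And>S. finite S \<Longrightarrow> S \<subseteq> I \<Longrightarrow> P (h + sum d S) = q (card S)"
    and "\<And>m. cmod (q m) \<le> B"
  shows "q m = q 0"
  using assms
proof (induction n arbitrary: P I q B m)
  case 0
  \<comment> \<open>An infinite index set has subsets of every finite size, so each
    \<open>q m\<close> is a value of \<open>P\<close>.\<close>
  have "q m = 0" for m
  proof -
    obtain S where "S \<subseteq> I" "finite S" "card S = m"
      using infinite_arbitrarily_large "0.prems"(2) by blast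
    then show ?thesis using 0 by (metis differences_vanish.simps(1))
  qed
  then show ?case by simp
next
  case (Suc n)
  obtain i where i: "i \<in> I" using Suc.prems(2) by fastforce
  \<comment> \<open>Differencing in the direction \<open>d i\<close> reserves the index
    \<open>i\<close> and replaces \<open>q\<close> by its first difference, now bounded by
    \<open>B + B\<close>.\<close>
  have "(\<lambda>m. q (Suc m) - q m) m = (\<lambda>m. q (Suc m) - q m) 0" for m
  proof (rule Suc.IH)
    show "differences_vanish n (\<lambda>f. P (f + d i) - P f)" using Suc.prems(1) by simp
    show "infinite (I - {i})" using Suc.prems(2) by simp
    show "cmod (q (Suc m) - q m) \<le> B + B" for m
      by (rule norm_triangle_le_diff) (use Suc.prems(4) add_mono in blast)
    fix S assume S: "finite S" "S \<subseteq> I - {i}"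
    then have "finite (insert i S)" "insert i S \<subseteq> I" "i \<notin> S" using i by auto
    then have "P (h + sum d (insert i S)) = q (Suc (card S))"
      using Suc.prems(3)[of "insert i S"] by simp
    moreover have "h + sum d (insert i S) = h + sum d S + d i"
      using S by (subst sum.insert) (auto simp: algebra_simps)
    moreover have "P (h + sum d S) = q (card S)" using Suc.prems(3) S by auto
    ultimately show "P (h + sum d S + d i) - P (h + sum d S) = q (Suc (card S)) - q (card S)"
      by simp
  qed
  then have const: "q (Suc m) - q m = q 1 - q 0" for m by simp
  have lin: "q m = q 0 + of_nat m * (q 1 - q 0)" for m
  proof (induction m)
    case (Suc m)
    have "q (Suc m) = q m + (q 1 - q 0)" using const[of m] by (metis add.commute diff_add_cancel)
    then show ?case by (simp add: Suc ring_distribs)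
  qed simp
  \<comment> \<open>A bounded affine sequence has slope zero.\<close>
  have "q 1 - q 0 = 0"
  proof (rule ccontr)
    assume "q 1 - q 0 \<noteq> 0"
    then have pos: "cmod (q 1 - q 0) > 0" by simp
    then obtain m :: nat where m: "real m * cmod (q 1 - q 0) > 2 * B"
      using reals_Archimedean3 by blast
    have "real m * cmod (q 1 - q 0) = cmod (q m - q 0)"
      using lin[of m] by (simp add: norm_mult)
    also have "\<dots> \<le> B + B"
      by (rule norm_triangle_le_diff) (use Suc.prems(4) add_mono in blast)
    finally show False using m by simp
  qed
  then show ?case using lin[of m] by simp
qed

text \<open>A polynomial of degree less than \<open>n\<close> with \<open>n\<close> zeros is zero.
  The difference along \<open>d\<close> loses one degree and one zero, so it vanishes by induction,
  and the zero at \<open>k = 0\<close> propagates.\<close>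

lemma differences_vanish_line_zero:
  fixes d :: "'a::real_vector"
  assumes "differences_vanish n P" and "\<And>k. k < n \<Longrightarrow> P (h + real k *\<^sub>R d) = 0"
  shows "P (h + real k *\<^sub>R d) = 0"
  using assms
proof (induction n arbitrary: P k)
  case (Suc n)
  have shift: "h + real k *\<^sub>R d + d = h + real (Suc k) *\<^sub>R d" for k
    by (simp add: algebra_simps)
  have "P (h + real k *\<^sub>R d + d) - P (h + real k *\<^sub>R d) = 0" for k
  proof (rule Suc.IH[of "\<lambda>f. P (f + d) - P f"])
    show "differences_vanish n (\<lambda>f. P (f + d) - P f)" using Suc.prems(1) by simp
    show "P (h + real k *\<^sub>R d + d) - P (h + real k *\<^sub>R d) = 0" if "k < n" for k
      unfolding shift using Suc.prems(2)[of k] Suc.prems(2)[of "Suc k"] that by simp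
  qed
  then have "P (h + real (Suc k) *\<^sub>R d) = P (h + real k *\<^sub>R d)" for k
    unfolding shift by simp
  then show ?case using Suc.prems(2)[of 0] by (induction k) auto
qed simp

text \<open>Small multiples of \<open>d\<close> already give \<open>P - P h\<close> more zeros than
  its degree permits.\<close>

lemma differences_vanish_line_constant:
  fixes d :: "'a::real_vector"
  assumes P: "differences_vanish (Suc n) P" and "\<epsilon> > 0"
    and small: "\<And>t. 0 \<le> t \<Longrightarrow> t < \<epsilon> \<Longrightarrow> P (h + t *\<^sub>R d) = P h"
  shows "P (h + d) = P h"
proof -
  \<comment> \<open>With steps of length \<open>1 / K\<close>, the first \<open>n + 1\<close> points
    stay below \<open>\<epsilon>\<close>, while step number \<open>K\<close> lands on
    \<open>h + d\<close>.\<close>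
  obtain K :: nat where K: "real K > (real n + 1) / \<epsilon>"
    using reals_Archimedean2 by blast
  then have Kpos: "real K > 0" using \<open>\<epsilon> > 0\<close> by (smt (verit) divide_pos_pos of_nat_0_le_iff)
  have nK: "real n / real K < \<epsilon>" using K Kpos \<open>\<epsilon> > 0\<close> by (simp add: field_simps)
  have "(\<lambda>f. P f - P h) (h + real K *\<^sub>R ((1 / real K) *\<^sub>R d)) = 0"
  proof (rule differences_vanish_line_zero)
    show "differences_vanish (Suc n) (\<lambda>f. P f - P h)" using P by simp
    fix k assume "k < Suc n"
    then have "real k / real K \<le> real n / real K" using Kpos by (intro divide_right_mono) auto
    then show "P (h + real k *\<^sub>R ((1 / real K) *\<^sub>R d)) - P h = 0"
      using small[of "real k / real K"] nK by simp
  qed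
  then show ?thesis using Kpos by simp
qed

section \<open>Monotone reparametrisations\<close>

text \<open>Allows paths to be written with real arithmetic in the parameter.
  \<open>Bcontfun\<close> is unspecified off the bounded continuous functions, hence the continuity
  premise of \<open>apply_of_fun\<close>.\<close>

definition of_fun :: "(real \<Rightarrow> complex) \<Rightarrow> C01" where
  "of_fun G = Bcontfun (\<lambda>s. G (coord s))"

lemma continuous_imp_bcontfun:
  assumes "continuous_on UNIV (F :: unit_interval \<Rightarrow> complex)"
  shows "F \<in> bcontfun"
  using assms compact_UNIV_unit_interval compact_continuous_image compact_imp_bounded
  by (auto simp: bcontfun_def)

lemma continuous_on_coord: "continuous_on UNIV coord"
  using homeomorphism_coord by (simp add: homeomorphism_def)

lemma continuous_on_unit_point: "continuous_on {0..1} unit_point"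
  using homeomorphism_coord by (simp add: homeomorphism_def)

lemma apply_of_fun:
  assumes "continuous_on {0..1} G"
  shows "apply_bcontfun (of_fun G) s = G (coord s)"
proof -
  have "continuous_on UNIV (\<lambda>s. G (coord s))"
    by (rule continuous_on_compose2[OF assms continuous_on_coord]) (use coord in auto)
  then show ?thesis
    unfolding of_fun_def by (simp add: Bcontfun_inverse continuous_imp_bcontfun)
qed

lemma of_fun_cong:
  "(\<And>x. 0 \<le> x \<Longrightarrow> x \<le> 1 \<Longrightarrow> F x = G x) \<Longrightarrow> of_fun F = of_fun G"
  unfolding of_fun_def using coord by (metis atLeastAtMost_iff)

lemma of_fun_unit_point: "of_fun (\<lambda>x. apply_bcontfun f (unit_point x)) = f"
  unfolding of_fun_def by (simp add: coord_inverse apply_bcontfun_inverse)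

lemma continuous_on_apply_unit_point:
  "continuous_on {0..1} (\<lambda>x. apply_bcontfun f (unit_point x))" for f :: C01
  by (rule continuous_on_compose2[OF _ continuous_on_unit_point, of UNIV]) auto

text \<open>A continuous bijection of a compact space onto a Hausdorff space is a homeomorphism, so
  \<open>\<phi>\<close> induces an element of \<open>H\<close>. It may reverse the interval, as in
  \<open>loop_at_end\<close>.\<close>

lemma H_invariant_of_fun:
  assumes P: "H_invariant P" and G: "continuous_on {0..1} G"
    and \<phi>: "continuous_on {0..1} \<phi>" "inj_on \<phi> {0..1}" "\<phi> ` {0..1} = {0..1}"
  shows "P (of_fun (\<lambda>x. G (\<phi> x))) = P (of_fun G)"
proof -
  let ?\<Phi> = "\<lambda>s. unit_point (\<phi> (coord s))"
  have im: "\<phi> (coord s) \<in> {0..1}" for s using \<phi>(3) coord by blast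
  have cont: "continuous_on UNIV ?\<Phi>"
  proof (rule continuous_on_compose2[OF continuous_on_unit_point])
    show "continuous_on UNIV (\<lambda>s. \<phi> (coord s))"
      by (rule continuous_on_compose2[OF \<phi>(1) continuous_on_coord]) (use coord in auto)
  qed (use im in auto)
  have "inj ?\<Phi>"
    by (rule injI) (metis \<phi>(2) coord coord_inject im inj_on_eq_iff unit_point_inverse)
  moreover have "range ?\<Phi> = UNIV"
  proof -
    have "\<exists>s. t = ?\<Phi> s" for t
    proof -
      obtain x where "x \<in> {0..1}" "\<phi> x = coord t" using \<phi>(3) coord by (metis imageE)
      then show ?thesis by (metis coord_inverse unit_point_inverse)
    qed
    then show ?thesis by auto
  qed
  ultimately obtain \<psi> where hom: "homeomorphism UNIV UNIV ?\<Phi> \<psi>"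
    using homeomorphism_compact[OF compact_UNIV_unit_interval cont] by blast
  define \<gamma> :: "C01 \<Rightarrow> C01" where "\<gamma> f = Bcontfun (apply_bcontfun f \<circ> ?\<Phi>)" for f
  have \<gamma>: "apply_bcontfun (\<gamma> f) = apply_bcontfun f \<circ> ?\<Phi>" for f
  proof -
    have "continuous_on UNIV (apply_bcontfun f \<circ> ?\<Phi>)"
      by (rule continuous_on_compose[OF cont]) (simp add: continuous_on_subset[of UNIV])
    then show ?thesis unfolding \<gamma>_def using Bcontfun_inverse continuous_imp_bcontfun by blast
  qed
  have "\<gamma> \<in> H" unfolding H_def using hom \<gamma> by blast
  then have "P (\<gamma> (of_fun G)) = P (of_fun G)"
    using P unfolding H_invariant_def by (metis comp_apply)
  moreover have "\<gamma> (of_fun G) = of_fun (\<lambda>x. G (\<phi> x))"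
  proof (rule bcontfun_eqI)
    fix s
    have "continuous_on {0..1} (\<lambda>x. G (\<phi> x))"
      by (rule continuous_on_compose2[OF G \<phi>(1)]) (use \<phi>(3) in auto)
    then show "\<gamma> (of_fun G) s = of_fun (\<lambda>x. G (\<phi> x)) s"
      using im by (simp add: \<gamma> apply_of_fun G unit_point_inverse)
  qed
  ultimately show ?thesis by simp
qed

text \<open>A monotone surjection \<open>\<phi>\<close> of the unit interval is the uniform limit of the
  homeomorphisms \<open>(1 - r) \<phi> + r id\<close> as \<open>r \<rightarrow> 0\<close>.\<close>

lemma H_invariant_mono_unit:
  assumes P: "H_invariant P" "continuous_on UNIV P" and G: "continuous_on {0..1} G"
    and \<phi>: "continuous_on {0..1} \<phi>" "mono_on {0..1} \<phi>" "\<phi> 0 = 0" "\<phi> 1 = (1::real)"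
  shows "P (of_fun (\<lambda>x. G (\<phi> x))) = P (of_fun G)"
proof -
  define \<theta> where "\<theta> r x = (1 - r) * \<phi> x + r * x" for r x
  have \<phi>01: "\<phi> x \<in> {0..1}" if "x \<in> {0..1}" for x
    using mono_onD[OF \<phi>(2), of 0 x] mono_onD[OF \<phi>(2), of x 1] that \<phi>(3,4) by auto
  have \<theta>01: "\<theta> r x \<in> {0..1}" if "0 \<le> r" "r \<le> 1" "x \<in> {0..1}" for r x
    using convexD[OF convex_real_interval(5), of "\<phi> x" 0 1 x "1 - r" r] \<phi>01 that
    by (auto simp: \<theta>_def)
  have \<theta>_cont: "continuous_on {0..1} (\<theta> r)" for r
    unfolding \<theta>_def by (intro continuous_intros \<phi>(1))
  have G\<theta>_cont: "continuous_on {0..1} (\<lambda>x. G (\<theta> r x))" if "0 \<le> r" "r \<le> 1" for r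
    by (rule continuous_on_compose2[OF G \<theta>_cont]) (use \<theta>01 that in auto)
  have G\<phi>_cont: "continuous_on {0..1} (\<lambda>x. G (\<phi> x))"
    by (rule continuous_on_compose2[OF G \<phi>(1)]) (use \<phi>01 in auto)
  have inv: "P (of_fun (\<lambda>x. G (\<theta> r x))) = P (of_fun G)" if r: "0 < r" "r \<le> 1" for r
  proof (rule H_invariant_of_fun[OF P(1) G \<theta>_cont])
    have "\<theta> r x < \<theta> r y" if "x \<in> {0..1}" "y \<in> {0..1}" "x < y" for x y
      unfolding \<theta>_def using mono_onD[OF \<phi>(2), of x y] that r
      by (intro add_le_less_mono mult_left_mono) auto
    then show "inj_on (\<theta> r) {0..1}"
      by (metis (no_types, lifting) inj_onI less_irrefl linorder_neqE)
    show "\<theta> r ` {0..1} = {0..1}"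
    proof
      show "\<theta> r ` {0..1} \<subseteq> {0..1}" using \<theta>01 r by auto
      show "{0..1} \<subseteq> \<theta> r ` {0..1}"
      proof
        fix y :: real assume "y \<in> {0..1}"
        moreover have "\<theta> r 0 = 0" "\<theta> r 1 = 1" by (auto simp: \<theta>_def \<phi>)
        ultimately have "\<exists>x\<ge>0. x \<le> 1 \<and> \<theta> r x = y"
          by (intro IVT' \<theta>_cont) auto
        then show "y \<in> \<theta> r ` {0..1}" by auto
      qed
    qed
  qed
  have "dist (P (of_fun (\<lambda>x. G (\<phi> x)))) (P (of_fun G)) < e" if e: "e > 0" for e
  proof -
    obtain \<delta> where \<delta>: "\<delta> > 0"
      "\<And>f. dist f (of_fun (\<lambda>x. G (\<phi> x))) < \<delta> \<Longrightarrow> dist (P f) (P (of_fun (\<lambda>x. G (\<phi> x)))) < e"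
      using P(2)[unfolded continuous_on_iff, rule_format, OF UNIV_I e] by auto
    have "uniformly_continuous_on {0..1} G"
      using G compact_uniformly_continuous by blast
    then obtain \<rho> where \<rho>: "\<rho> > 0"
      "\<And>x y. x \<in> {0..1} \<Longrightarrow> y \<in> {0..1} \<Longrightarrow> dist y x < \<rho> \<Longrightarrow> dist (G y) (G x) < \<delta> / 2"
      using \<delta>(1) unfolding uniformly_continuous_on_def by (metis half_gt_zero)
    \<comment> \<open>\<open>\<theta> r\<close> and \<open>\<phi>\<close> differ by at most
      \<open>r\<close>, so \<open>r < \<rho>\<close> makes the paths
      \<open>\<delta> / 2\<close>-close; \<open>r \<le> 1\<close> keeps \<open>\<theta> r\<close> a
      convex combination.\<close>
    define r where "r = min 1 (\<rho> / 2)"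
    have r: "0 < r" "r \<le> 1" "r < \<rho>" using \<rho>(1) by (auto simp: r_def)
    have "dist (of_fun (\<lambda>x. G (\<theta> r x))) (of_fun (\<lambda>x. G (\<phi> x))) \<le> \<delta> / 2"
    proof (rule dist_bound)
      fix s
      let ?x = "coord s"
      have x: "?x \<in> {0..1}" by (rule coord)
      have "\<theta> r ?x - \<phi> ?x = r * (?x - \<phi> ?x)"
        by (simp add: \<theta>_def algebra_simps)
      then have "\<bar>\<theta> r ?x - \<phi> ?x\<bar> = r * \<bar>?x - \<phi> ?x\<bar>" using r by (simp add: abs_mult)
      also have "\<dots> \<le> r * 1" using x \<phi>01[OF x] r by (intro mult_left_mono) auto
      finally have "dist (\<theta> r ?x) (\<phi> ?x) < \<rho>" using r by (simp add: dist_real_def)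
      then have "dist (G (\<theta> r ?x)) (G (\<phi> ?x)) < \<delta> / 2"
        using \<rho>(2) \<theta>01 \<phi>01 x r by simp
      then show "dist (of_fun (\<lambda>x. G (\<theta> r x)) s) (of_fun (\<lambda>x. G (\<phi> x)) s) \<le> \<delta> / 2"
        using r by (simp add: apply_of_fun G\<theta>_cont G\<phi>_cont)
    qed
    then have "dist (of_fun (\<lambda>x. G (\<theta> r x))) (of_fun (\<lambda>x. G (\<phi> x))) < \<delta>"
      using \<delta>(1) by linarith
    then have "dist (P (of_fun (\<lambda>x. G (\<theta> r x)))) (P (of_fun (\<lambda>x. G (\<phi> x)))) < e" by (rule \<delta>(2))
    then show ?thesis using inv[OF r(1,2)] by (simp add: dist_commute)
  qed
  then show ?thesis by (metis less_irrefl zero_less_dist_iff)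
qed

lemma continuous_on_affine_segment:
  fixes G :: "real \<Rightarrow> complex"
  assumes "continuous_on {a..c} G" and "a \<le> p" "p \<le> q" "q \<le> c"
  shows "continuous_on {0..1} (\<lambda>u. G (p + (q - p) * u))"
proof (rule continuous_on_compose2[OF assms(1)])
  show "(\<lambda>u. p + (q - p) * u) ` {0..1} \<subseteq> {a..c}"
  proof clarify
    fix u :: real assume "u \<in> {0..1}"
    then have "0 \<le> (q - p) * u" "(q - p) * u \<le> (q - p) * 1"
      using assms by (intro mult_nonneg_nonneg mult_left_mono; simp)+
    then show "p + (q - p) * u \<in> {a..c}" using assms by auto
  qed
qed (intro continuous_intros)

text \<open>Rescaling \<open>{a..b}\<close> reduces this to \<open>H_invariant_mono_unit\<close>.
  The constant-speed path serves as the normal form of all monotone traversals, pauses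
  included.\<close>

lemma H_invariant_mono:
  assumes P: "H_invariant P" "continuous_on UNIV P" and G: "continuous_on {a..b} G"
    and \<phi>: "continuous_on {0..1} \<phi>" "mono_on {0..1} \<phi>" "\<phi> 0 = a" "\<phi> 1 = (b::real)" "a < b"
  shows "P (of_fun (\<lambda>x. G (\<phi> x))) = P (of_fun (\<lambda>x. G (a + (b - a) * x)))"
proof -
  let ?\<phi> = "\<lambda>x. (\<phi> x - a) / (b - a)"
  have "P (of_fun (\<lambda>x. G (a + (b - a) * ?\<phi> x))) = P (of_fun (\<lambda>x. G (a + (b - a) * x)))"
  proof (rule H_invariant_mono_unit[OF P])
    show "continuous_on {0..1} (\<lambda>x. G (a + (b - a) * x))"
      by (rule continuous_on_affine_segment[OF G]) (use \<phi>(5) in auto)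
    show "continuous_on {0..1} ?\<phi>" using \<phi>(5) by (intro continuous_intros \<phi>(1)) auto
    show "mono_on {0..1} ?\<phi>"
      using \<phi>(5) by (intro mono_onI divide_right_mono diff_right_mono mono_onD[OF \<phi>(2)]) auto
  qed (use \<phi> in auto)
  then show ?thesis using \<phi>(5) by simp
qed

section \<open>Inserting loops\<close>

text \<open>Retraction of the line onto the unit interval; used as a change of parameter, it makes a
  path wait at its ends.\<close>

definition clamp01 :: "real \<Rightarrow> real" where
  "clamp01 y = max 0 (min 1 y)"

lemma clamp01_bounds [simp]: "0 \<le> clamp01 y" "clamp01 y \<le> 1"
  by (auto simp: clamp01_def)

lemma continuous_on_clamp01 [continuous_intros]:
  "continuous_on A f \<Longrightarrow> continuous_on A (\<lambda>x. clamp01 (f x))"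
  unfolding clamp01_def by (intro continuous_intros)

lemma clamp01_mono: "x \<le> y \<Longrightarrow> clamp01 x \<le> clamp01 y"
  by (auto simp: clamp01_def)

text \<open>In \<open>ramp j\<close> the index \<open>j\<close> stands for the slot \<open>[2\<^sup>-\<^sup>j\<^sup>-\<^sup>2, 2\<^sup>-\<^sup>j\<^sup>-\<^sup>1]\<close>; later slots come
  with smaller indices.\<close>

definition ramp :: "nat \<Rightarrow> real \<Rightarrow> real" where
  "ramp j x = clamp01 (2 ^ (j + 2) * x - 1)"

lemma ramp_bounds [simp]: "0 \<le> ramp j x" "ramp j x \<le> 1"
  by (auto simp: ramp_def)

text \<open>Once slot \<open>j\<close> has begun, \<open>2 ^ (j + 2) * x\<close> exceeds 1; a larger
  index at least doubles it, which takes \<open>ramp k\<close> to its cap.\<close>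

lemma ramp_eq_1:
  assumes "j < k" "ramp j x > 0"
  shows "ramp k x = 1"
proof -
  have x: "2 ^ (j + 2) * x > 1" using assms(2) by (auto simp: ramp_def clamp01_def split: if_splits)
  then have "x > 0" by (smt (verit) mult_nonneg_nonpos zero_le_power)
  have "2 * (2 ^ (j + 2) * x) = 2 ^ (Suc j + 2) * x" by simp
  also have "\<dots> \<le> 2 ^ (k + 2) * x"
    using assms(1) \<open>x > 0\<close> by (intro mult_right_mono power_increasing) auto
  finally show ?thesis using x unfolding ramp_def clamp01_def by linarith
qed

lemma ramp_0 [simp]: "ramp j 0 = 0"
  by (simp add: ramp_def clamp01_def)

text \<open>All slots lie in the first half of the interval; the second half is kept for the path
  that follows the loops.\<close>

lemma ramp_late:
  assumes "x \<ge> 1/2"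
  shows "ramp j x = 1"
proof -
  have "(2::real) ^ 2 * (1/2) \<le> 2 ^ (j + 2) * x"
    using assms by (intro mult_mono power_increasing) auto
  then show ?thesis by (simp add: ramp_def clamp01_def)
qed

text \<open>At any moment at most one loop is under way, and the others, not begun or completed,
  contribute 0. So a sum of arbitrarily many loops is no larger than one loop.\<close>

lemma sum_loops_single:
  fixes \<theta> :: "nat \<Rightarrow> real"
  assumes "finite S" and \<theta>: "\<And>j. 0 \<le> \<theta> j" "\<And>j. \<theta> j \<le> 1"
    and ord: "\<And>j k. j < k \<Longrightarrow> \<theta> j > 0 \<Longrightarrow> \<theta> k = 1"
    and v: "v 0 = (0::complex)" "v 1 = 0"
  shows "\<exists>u\<in>{0..1}. (\<Sum>j\<in>S. v (\<theta> j)) = v u"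
  using assms(1)
proof (induction S rule: finite_linorder_max_induct)
  case empty
  show ?case using v by (intro bexI[of _ 0]) auto
next
  case (insert b S)
  then have b: "b \<notin> S" by blast
  show ?case
  proof (cases "\<theta> b = 1")
    case True
    then show ?thesis using insert b v by simp
  next
    case False
    then have "\<theta> j = 0" if "j \<in> S" for j
      using ord[of j b] insert(2) \<theta>(1)[of j] that False by force
    then have "(\<Sum>j\<in>S. v (\<theta> j)) = 0" using v by simp
    then show ?thesis using insert(1) b \<theta> by (intro bexI[of _ "\<theta> b"]) auto
  qed
qed

text \<open>The clock \<open>sum \<theta> S\<close> counts the completed loops plus the fraction of
  the current one. Read at this clock, a concatenation of \<open>card S\<close> loops gives the sum,
  so only the number of slots matters.\<close>

lemma sum_loops_unroll:
  fixes \<theta> :: "nat \<Rightarrow> real"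
  assumes "finite S" and \<theta>: "\<And>j. 0 \<le> \<theta> j" "\<And>j. \<theta> j \<le> 1"
    and ord: "\<And>j k. j < k \<Longrightarrow> \<theta> j > 0 \<Longrightarrow> \<theta> k = 1"
    and v: "v 0 = (0::complex)" "v 1 = 0"
  shows "(\<Sum>i<card S. v (clamp01 (sum \<theta> S - real i))) = (\<Sum>j\<in>S. v (\<theta> j))"
  using assms(1)
proof (induction S rule: finite_linorder_max_induct)
  case (insert b S)
  then have b: "b \<notin> S" by blast
  \<comment> \<open>The largest index is the earliest slot, so it becomes the first loop and the
    others move up by one.\<close>
  have split: "(\<Sum>i<card (insert b S). v (clamp01 (sum \<theta> (insert b S) - real i)))
    = v (clamp01 (\<theta> b + sum \<theta> S)) + (\<Sum>i<card S. v (clamp01 (\<theta> b + sum \<theta> S - real (Suc i))))"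
    using insert(1) b by (simp add: sum.lessThan_Suc_shift del: sum.lessThan_Suc of_nat_Suc)
  have pos: "sum \<theta> S \<ge> 0" using \<theta> by (intro sum_nonneg)
  show ?case
  proof (cases "\<theta> b = 1")
    case True
    then have "clamp01 (\<theta> b + sum \<theta> S) = 1" using pos by (simp add: clamp01_def)
    then show ?thesis unfolding split using insert b v True by simp
  next
    case False
    then have 0: "\<theta> j = 0" if "j \<in> S" for j
      using ord[of j b] insert(2) \<theta>(1)[of j] that False by force
    have "clamp01 (\<theta> b) = \<theta> b" using \<theta> by (simp add: clamp01_def)
    moreover have "clamp01 (\<theta> b - real (Suc i)) = 0" for i
      using \<theta>(2)[of b] by (simp add: clamp01_def)
    ultimately show ?thesis unfolding split using insert(1) b v 0 by simp
  qed
qed simp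

lemma apply_bcontfun_sum: "apply_bcontfun (\<Sum>i\<in>I. f i) s = (\<Sum>i\<in>I. apply_bcontfun (f i) s)"
  for f :: "'i \<Rightarrow> C01"
  by (induction I rule: infinite_finite_induct) (auto simp: plus_bcontfun.rep_eq zero_bcontfun.rep_eq)

lemma of_fun_add:
  assumes "continuous_on {0..1} F" "continuous_on {0..1} G"
  shows "of_fun F + of_fun G = of_fun (\<lambda>x. F x + G x)"
  by (rule bcontfun_eqI) (simp add: apply_of_fun assms continuous_on_add plus_bcontfun.rep_eq)

lemma ramp_mono: "x \<le> y \<Longrightarrow> ramp j x \<le> ramp j y"
  unfolding ramp_def by (intro clamp01_mono diff_right_mono mult_left_mono) auto

lemma continuous_on_ramp [continuous_intros]: "continuous_on A (ramp j)"
  unfolding ramp_def by (intro continuous_intros)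

text \<open>Inserting \<open>m\<close> copies of a loop, scaled by a small \<open>t\<close>, into a constant stretch of a path
  stays in a fixed neighbourhood of the path, and by invariance the value of \<open>P\<close> depends only
  on \<open>m\<close>. So it is a bounded polynomial in \<open>m\<close>, hence constant; as a polynomial in \<open>t\<close> it is
  then constant as well.\<close>

lemma loop_at_start:
  assumes P: "H_invariant P" "continuous_on UNIV P" "differences_vanish (Suc n) P"
    and G: "continuous_on {a..c} G" and ab: "a < b" and bc: "b < c" and loop: "G a = G b"
  shows "P (of_fun (\<lambda>x. G (a + (c - a) * x))) = P (of_fun (\<lambda>x. G (b + (c - b) * x)))"
proof -
  \<comment> \<open>\<open>v\<close> is the loop translated to 0, \<open>k\<close> the rest of the
    path, \<open>h\<close> the path that waits for half the time and then runs \<open>k\<close>, and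
    \<open>d j\<close> the loop in slot \<open>j\<close>.\<close>
  define v where "v u = G (a + (b - a) * u) - G a" for u
  define k where "k u = G (b + (c - b) * u)" for u
  define h where "h x = k (clamp01 (2 * x - 1))" for x
  define d where "d j = of_fun (\<lambda>x. v (ramp j x))" for j
  \<comment> \<open>On \<open>[0, m]\<close> this path runs through \<open>m\<close> loops scaled by
    \<open>t\<close>, on \<open>[m, m + 1]\<close> through \<open>k\<close>.\<close>
  define L where "L t m y = k (clamp01 (y - real m)) + of_real t * (\<Sum>i<m. v (clamp01 (y - real i)))"
    for t m y
  \<comment> \<open>The parameter is left unsimplified to match the normal form of
    \<open>H_invariant_mono\<close> with \<open>a = 0\<close>.\<close>
  define q where "q t m = P (of_fun (\<lambda>x. L t m (0 + (real m + 1 - 0) * x)))" for t m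
  have v_cont: "continuous_on {0..1} v"
    unfolding v_def by (intro continuous_intros continuous_on_affine_segment[OF G]) (use ab bc in auto)
  have k_cont: "continuous_on {0..1} k"
    unfolding k_def by (intro continuous_intros continuous_on_affine_segment[OF G]) (use ab bc in auto)
  have v01: "v 0 = 0" "v 1 = 0" using loop by (auto simp: v_def)
  have h_cont: "continuous_on {0..1} h"
    unfolding h_def by (rule continuous_on_compose2[OF k_cont]) (auto intro!: continuous_intros)
  have vr_cont: "continuous_on {0..1} (\<lambda>x. v (ramp j x))" for j
    by (rule continuous_on_compose2[OF v_cont]) (auto intro!: continuous_intros)
  have L_cont: "continuous_on A (L t m)" for A t m
  proof -
    have "continuous_on A (\<lambda>y. k (clamp01 (y - real m)))"
      by (rule continuous_on_compose2[OF k_cont]) (auto intro!: continuous_intros)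
    moreover have "continuous_on A (\<lambda>y. v (clamp01 (y - real i)))" for i
      by (rule continuous_on_compose2[OF v_cont]) (auto intro!: continuous_intros)
    ultimately show ?thesis unfolding L_def by (intro continuous_intros)
  qed
  have early: "clamp01 (2 * x - 1) = 0" if "x \<le> 1/2" for x using that by (simp add: clamp01_def)
  \<comment> \<open>In the first half \<open>k\<close> waits while the clock counts loops; in the
    second all loops are complete and only \<open>k\<close> moves.\<close>
  have unroll: "L t (card S) ((\<Sum>j\<in>S. ramp j x) + clamp01 (2 * x - 1))
      = h x + of_real t * (\<Sum>j\<in>S. v (ramp j x))" if S: "finite S" for S t x
  proof (cases "x \<le> 1/2")
    case True
    have "(\<Sum>j\<in>S. ramp j x) \<le> (\<Sum>j\<in>S. 1)" by (intro sum_mono) auto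
    then have "clamp01 ((\<Sum>j\<in>S. ramp j x) - real (card S)) = 0" by (simp add: clamp01_def)
    then show ?thesis
      using sum_loops_unroll[OF S, of "\<lambda>j. ramp j x" v] ramp_eq_1 v01 early[OF True]
      by (simp add: L_def h_def)
  next
    case False
    then have r1: "ramp j x = 1" for j by (simp add: ramp_late)
    have "clamp01 (real (card S) + clamp01 (2 * x - 1) - real i) = 1" if "i < card S" for i
    proof -
      have "real i + 1 \<le> real (card S)" using that by linarith
      then show ?thesis using clamp01_bounds(1)[of "2 * x - 1"] by (simp add: clamp01_def)
    qed
    then show ?thesis using r1 v01 by (simp add: L_def h_def) (simp add: clamp01_def)
  qed
  \<comment> \<open>By \<open>unroll\<close> the perturbed path is a monotone reparametrisation of
    \<open>L t (card S)\<close>.\<close>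
  have q: "P (of_fun h + (\<Sum>j\<in>S. t *\<^sub>R d j)) = q t (card S)" if S: "finite S" for S t
  proof -
    let ?\<phi> = "\<lambda>x. (\<Sum>j\<in>S. ramp j x) + clamp01 (2 * x - 1)"
    have L\<phi>_cont: "continuous_on {0..1} (\<lambda>x. L t (card S) (?\<phi> x))"
      by (rule continuous_on_compose2[OF L_cont[of UNIV]]) (auto intro!: continuous_intros)
    have "of_fun h + (\<Sum>j\<in>S. t *\<^sub>R d j) = of_fun (\<lambda>x. L t (card S) (?\<phi> x))"
    proof (rule bcontfun_eqI)
      fix s
      show "(of_fun h + (\<Sum>j\<in>S. t *\<^sub>R d j)) s = of_fun (\<lambda>x. L t (card S) (?\<phi> x)) s"
        by (subst apply_of_fun[OF L\<phi>_cont], subst unroll[OF S], unfold plus_bcontfun.rep_eq apply_bcontfun_sum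
          scaleR_bcontfun.rep_eq d_def apply_of_fun[OF vr_cont] apply_of_fun[OF h_cont])
           (simp add: scaleR_conv_of_real sum_distrib_left)
    qed
    moreover have "P (of_fun (\<lambda>x. L t (card S) (?\<phi> x))) = q t (card S)"
      unfolding q_def
    proof (rule H_invariant_mono[OF P(1,2) L_cont])
      show "mono_on {0..1} ?\<phi>"
        by (intro mono_onI add_mono sum_mono ramp_mono clamp01_mono) auto
    qed (auto intro!: continuous_intros simp: ramp_late, auto simp: clamp01_def)
    ultimately show ?thesis by simp
  qed
  have "bounded (v ` {0..1})" using v_cont compact_continuous_image compact_imp_bounded by blast
  then obtain M where M: "M > 0" "\<And>u. u \<in> {0..1} \<Longrightarrow> cmod (v u) \<le> M"
    unfolding bounded_pos by blast
  obtain \<delta> where \<delta>: "\<delta> > 0" "\<And>f. dist f (of_fun h) < \<delta> \<Longrightarrow> dist (P f) (P (of_fun h)) < 1"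
    using P(2)[unfolded continuous_on_iff, rule_format, OF UNIV_I zero_less_one] by auto
  have small: "P (of_fun h + t *\<^sub>R d 0) = P (of_fun h)" if t: "0 \<le> t" "t < \<delta> / M" for t
  proof -
    have bound: "cmod (q t m) \<le> cmod (P (of_fun h)) + 1" for m
    proof -
      \<comment> \<open>By \<open>sum_loops_single\<close> this bound does not grow with
        \<open>m\<close>.\<close>
      have "norm (\<Sum>j<m. t *\<^sub>R d j) \<le> t * M"
      proof (rule norm_bound)
        fix s
        obtain u where u: "u \<in> {0..1}" "(\<Sum>j<m. v (ramp j (coord s))) = v u"
          using sum_loops_single[of "{..<m}" "\<lambda>j. ramp j (coord s)" v] ramp_eq_1 v01 by auto
        have "(\<Sum>j<m. t *\<^sub>R d j) s = of_real t * (\<Sum>j<m. v (ramp j (coord s)))"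
          unfolding apply_bcontfun_sum scaleR_bcontfun.rep_eq d_def apply_of_fun[OF vr_cont]
          by (simp add: scaleR_conv_of_real sum_distrib_left)
        then show "cmod ((\<Sum>j<m. t *\<^sub>R d j) s) \<le> t * M"
          using u M(2)[OF u(1)] t by (simp add: norm_mult mult_left_mono)
      qed
      also have "t * M < \<delta>" using t M by (simp add: field_simps)
      finally have "dist (of_fun h + (\<Sum>j<m. t *\<^sub>R d j)) (of_fun h) < \<delta>" by (simp add: dist_norm)
      then have "dist (P (of_fun h + (\<Sum>j<m. t *\<^sub>R d j))) (P (of_fun h)) < 1" by (rule \<delta>(2))
      then have "dist (q t m) (P (of_fun h)) < 1" using q[of "{..<m}" t] by simp
      then show ?thesis using norm_triangle_sub[of "q t m" "P (of_fun h)"] by (simp add: dist_norm)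
    qed
    have "q t 1 = q t 0"
    proof (rule bounded_differences_vanish_imp_constant[OF P(3)])
      show "infinite (UNIV :: nat set)" by simp
      show "P (of_fun h + (\<Sum>j\<in>S. t *\<^sub>R d j)) = q t (card S)" if "finite S" for S
        using q[OF that] .
      show "cmod (q t m) \<le> cmod (P (of_fun h)) + 1" for m by (rule bound)
    qed
    then show ?thesis using q[of "{0}" t] q[of "{}" t] by simp
  qed
  have "P (of_fun h + d 0) = P (of_fun h)"
    by (rule differences_vanish_line_constant[OF P(3) _ small]) (use \<delta> M in auto)
  moreover have "P (of_fun h) = P (of_fun k)"
    unfolding h_def
    by (rule H_invariant_mono_unit[OF P(1,2) k_cont])
       (auto intro!: continuous_intros mono_onI clamp01_mono, auto simp: clamp01_def)
  moreover have "P (of_fun h + d 0) = P (of_fun (\<lambda>x. G (a + (c - a) * x)))"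
  proof -
    \<comment> \<open>\<open>ramp 0\<close> leads from \<open>a\<close> to \<open>b\<close> within
      the first half, the clamped term from \<open>b\<close> to \<open>c\<close> in the second;
      \<open>G a = G b\<close> fits the two together.\<close>
    let ?\<phi> = "\<lambda>x. a + (b - a) * ramp 0 x + (c - b) * clamp01 (2 * x - 1)"
    have "of_fun h + d 0 = of_fun (\<lambda>x. h x + v (ramp 0 x))"
      unfolding d_def by (rule of_fun_add[OF h_cont vr_cont])
    also have "\<dots> = of_fun (\<lambda>x. G (?\<phi> x))"
    proof (rule of_fun_cong)
      fix x :: real
      show "h x + v (ramp 0 x) = G (?\<phi> x)"
      proof (cases "x \<le> 1/2")
        case True
        then show ?thesis using early[OF True] loop by (simp add: h_def k_def v_def)
      next
        case False
        then show ?thesis using v01 by (simp add: h_def k_def ramp_late)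
      qed
    qed
    finally have "P (of_fun h + d 0) = P (of_fun (\<lambda>x. G (?\<phi> x)))" by simp
    also have "\<dots> = P (of_fun (\<lambda>x. G (a + (c - a) * x)))"
    proof (rule H_invariant_mono[OF P(1,2) G])
      show "mono_on {0..1} ?\<phi>"
        using ab bc by (intro mono_onI add_mono mult_left_mono clamp01_mono ramp_mono) auto
    qed (use ab bc in \<open>auto intro!: continuous_intros simp: ramp_late clamp01_def\<close>)
    finally show ?thesis .
  qed
  ultimately show ?thesis by (simp add: k_def[abs_def])
qed

text \<open>Reversal of the interval is a homeomorphism, so this is \<open>loop_at_start\<close> for
  \<open>\<lambda>y. G (- y)\<close>.\<close>

lemma loop_at_end:
  assumes P: "H_invariant P" "continuous_on UNIV P" "differences_vanish (Suc n) P"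
    and G: "continuous_on {a..c} G" and ab: "a < b" and bc: "b < c" and loop: "G b = G c"
  shows "P (of_fun (\<lambda>x. G (a + (c - a) * x))) = P (of_fun (\<lambda>x. G (a + (b - a) * x)))"
proof -
  have rev: "P (of_fun (\<lambda>x. G (y - (y - a) * x))) = P (of_fun (\<lambda>x. G (a + (y - a) * x)))"
    if "a \<le> y" "y \<le> c" for y
  proof -
    have "P (of_fun (\<lambda>x. (\<lambda>x. G (a + (y - a) * x)) (1 - x))) = P (of_fun (\<lambda>x. G (a + (y - a) * x)))"
    proof (rule H_invariant_of_fun[OF P(1), where \<phi> = "\<lambda>x. 1 - x"])
      show "continuous_on {0..1} (\<lambda>x. G (a + (y - a) * x))"
        by (rule continuous_on_affine_segment[OF G]) (use that in auto)
    qed (auto intro!: continuous_intros inj_onI)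
    then show ?thesis by (simp add: algebra_simps)
  qed
  have "P (of_fun (\<lambda>x. G (- (- c + (- a - - c) * x)))) = P (of_fun (\<lambda>x. G (- (- b + (- a - - b) * x))))"
  proof (rule loop_at_start[OF P, where G = "\<lambda>y. G (- y)" and a = "- c" and b = "- b" and c = "- a"])
    show "continuous_on {- c..- a} (\<lambda>y. G (- y))"
      by (rule continuous_on_compose2[OF G]) (auto intro!: continuous_intros)
  qed (use ab bc loop in auto)
  then show ?thesis using rev[of b] rev[of c] ab bc by (simp add: algebra_simps)
qed

section \<open>Joining two paths with common endpoints\<close>

lemma unit_point_0 [simp]: "unit_point 0 = 0" and unit_point_1 [simp]: "unit_point 1 = 1"
  by (simp_all add: zero_unit_interval_def one_unit_interval_def)

text \<open>The path that runs through \<open>f\<close>, then \<open>h\<close> backwards, then \<open>h\<close> starts with a loop followed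
  by \<open>h\<close>, and ends with a loop preceded by \<open>f\<close>.\<close>

lemma H_invariant_depends_on_endpoints:
  fixes f h :: C01
  assumes "continuous_polynomial P" "H_invariant P" and "f 0 = h 0" "f 1 = h 1"
  shows "P f = P h"
proof -
  obtain n where n: "differences_vanish (Suc n) P"
    using assms(1) differences_vanish_polynomial unfolding continuous_polynomial_def by blast
  have P: "H_invariant P" "continuous_on UNIV P" "differences_vanish (Suc n) P"
    using assms n unfolding continuous_polynomial_def by auto
  define F where "F = (\<lambda>x. f (unit_point x))"
  define K where "K = (\<lambda>x. h (unit_point x))"
  \<comment> \<open>For \<open>F 1 = K 1\<close>, \<open>T\<close> is \<open>F\<close> on
    \<open>[0, 1]\<close>, \<open>K\<close> backwards on \<open>[1, 2]\<close> and \<open>K\<close>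
    forwards on \<open>[2, 3]\<close>. Common endpoints give \<open>T 0 = T 2\<close> and
    \<open>T 1 = T 3\<close>, the two loops to be removed.\<close>
  define T where "T y = F (min 1 y) + K \<bar>max 1 y - 2\<bar> - K 1" for y
  have FK: "continuous_on {0..1} F" "continuous_on {0..1} K"
    unfolding F_def K_def by (rule continuous_on_apply_unit_point)+
  have "continuous_on {0..3} (\<lambda>y. F (min 1 y))"
    by (rule continuous_on_compose2[OF FK(1)]) (auto intro!: continuous_intros)
  moreover have "continuous_on {0..3} (\<lambda>y. K \<bar>max 1 y - 2\<bar>)"
    by (rule continuous_on_compose2[OF FK(2)]) (auto intro!: continuous_intros)
  ultimately have T: "continuous_on {0..3} T"
    unfolding T_def by (intro continuous_intros)
  have ends: "F 0 = K 0" "F 1 = K 1" using assms by (auto simp: F_def K_def)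
  have "P (of_fun (\<lambda>x. T (0 + (3 - 0) * x))) = P (of_fun (\<lambda>x. T (2 + (3 - 2) * x)))"
    by (rule loop_at_start[OF P T]) (auto simp: T_def ends)
  also have "of_fun (\<lambda>x. T (2 + (3 - 2) * x)) = of_fun K"
    by (rule of_fun_cong) (auto simp: T_def ends)
  finally have 1: "P (of_fun (\<lambda>x. T (0 + (3 - 0) * x))) = P h"
    by (simp only: of_fun_unit_point K_def)
  have "P (of_fun (\<lambda>x. T (0 + (3 - 0) * x))) = P (of_fun (\<lambda>x. T (0 + (1 - 0) * x)))"
    by (rule loop_at_end[OF P T]) (auto simp: T_def ends)
  also have "of_fun (\<lambda>x. T (0 + (1 - 0) * x)) = of_fun F"
    by (rule of_fun_cong) (auto simp: T_def ends)
  finally show ?thesis using 1 by (simp only: of_fun_unit_point F_def)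
qed

section \<open>Polynomials in the values at the endpoints\<close>

text \<open>A continuous injection of an interval is strictly monotone, so no interior point reaches
  0 or 1; the preimages of 0 and 1 are therefore the endpoints.\<close>

lemma homeomorphism_unit_interval_endpoints:
  fixes \<phi> :: "unit_interval \<Rightarrow> unit_interval"
  assumes "homeomorphism UNIV UNIV \<phi> \<psi>"
  shows "\<phi> 0 = 0 \<and> \<phi> 1 = 1 \<or> \<phi> 0 = 1 \<and> \<phi> 1 = 0"
proof -
  have cont: "continuous_on UNIV \<phi>" and surj: "surj \<phi>" and inv: "\<psi> (\<phi> s) = s" for s
    using assms by (auto simp: homeomorphism_def)
  have inj: "inj \<phi>" using inv by (rule inj_on_inverseI)
  let ?c = "\<lambda>x. coord (\<phi> (unit_point x))"
  have c_cont: "continuous_on {0..1} ?c"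
    by (rule continuous_on_compose2[OF continuous_on_coord
          continuous_on_compose2[OF cont continuous_on_unit_point]]) auto
  have c_inj: "inj_on ?c {0..1}"
    by (rule inj_onI) (metis coord_inject inj injD unit_point_inverse)
  have c01: "0 \<le> ?c x" "?c x \<le> 1" for x
    using coord[of "\<phi> (unit_point x)"] by auto
  have ends: "s = 0 \<or> s = 1" if s: "coord (\<phi> s) = 0 \<or> coord (\<phi> s) = 1" for s
  proof (rule ccontr)
    assume ns: "\<not> (s = 0 \<or> s = 1)"
    have "coord s \<noteq> 0" "coord s \<noteq> 1"
      using ns by (metis coord_inverse unit_point_0, metis coord_inverse unit_point_1)
    then have "0 < coord s" "coord s < 1" using coord[of s] by auto
    then have "?c 0 < ?c (coord s) \<and> ?c (coord s) < ?c 1 \<or> ?c 1 < ?c (coord s) \<and> ?c (coord s) < ?c 0"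
      using continuous_inj_imp_mono[OF _ _ c_cont c_inj] by blast
    then show False using s c01[of 0] c01[of 1] by (auto simp: coord_inverse)
  qed
  obtain p p' where p: "\<phi> p = 0" "\<phi> p' = 1" using surj by (metis surjD)
  then have "coord (\<phi> p) = 0" "coord (\<phi> p') = 1"
    by (simp_all add: zero_unit_interval.rep_eq one_unit_interval.rep_eq)
  moreover from this have "p \<noteq> p'" by auto
  ultimately show ?thesis using ends[of p] ends[of p'] p by auto
qed

lemma H_invariant_symmetric:
  assumes "\<And>x y. S x y = S y x"
  shows "H_invariant (\<lambda>f::C01. S (f 0) (f 1))"
  unfolding H_invariant_def
proof
  fix \<gamma> assume "\<gamma> \<in> H"
  then obtain \<phi> \<psi> where \<phi>: "homeomorphism UNIV UNIV \<phi> \<psi>"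
    and \<gamma>: "\<And>f. apply_bcontfun (\<gamma> f) = apply_bcontfun f \<circ> \<phi>"
    unfolding H_def by blast
  show "(\<lambda>f::C01. S (f 0) (f 1)) \<circ> \<gamma> = (\<lambda>f::C01. S (f 0) (f 1))"
    using homeomorphism_unit_interval_endpoints[OF \<phi>] assms[of "_ 1" "_ 0"] by (auto simp: fun_eq_iff \<gamma>)
qed

text \<open>Each argument enters exactly one factor. The choice of evaluation points
  \<open>p\<close> covers both the product and the powers of endpoint values.\<close>

lemma multilinear_form_prod: "multilinear_form m (\<lambda>x. \<Prod>i<m. x i (p i))"
proof -
  have upd: "(\<Prod>j<m. (x(i := u)) j (p j)) = u (p i) * (\<Prod>j\<in>{..<m} - {i}. x j (p j))"
    if "i < m" for x :: "nat \<Rightarrow> C01" and i u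
    using that by (subst prod.remove[of _ i]) auto
  show ?thesis
    unfolding multilinear_form_def
  proof (intro conjI allI impI)
    fix x y :: "nat \<Rightarrow> C01" assume "\<forall>i<m. x i = y i"
    then show "(\<Prod>i<m. x i (p i)) = (\<Prod>i<m. y i (p i))" by (intro prod.cong) auto
  qed (simp_all add: upd plus_bcontfun.rep_eq scaleC.rep_eq ring_distribs del: fun_upd_apply)
qed

lemma multilinear_form_add:
  "multilinear_form m A \<Longrightarrow> multilinear_form m B \<Longrightarrow> multilinear_form m (\<lambda>x. A x + B x)"
  unfolding multilinear_form_def by (simp add: ring_distribs) metis

lemma homogeneous_imp_polynomial:
  assumes "homogeneous_polynomial n P"
  shows "polynomial P"
proof -
  have zero: "homogeneous_polynomial m (\<lambda>_. 0)" for m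
    unfolding homogeneous_polynomial_def multilinear_form_def by (intro exI[of _ "\<lambda>_. 0"]) simp
  let ?Q = "\<lambda>m. if m = n then P else (\<lambda>_. 0)"
  have "(\<Sum>m\<le>n. ?Q m f) = P f" for f
    by (subst sum.remove[of _ n]) auto
  then show ?thesis
    unfolding polynomial_def using assms zero by (intro exI[of _ n] exI[of _ ?Q]) auto
qed

lemma continuous_on_eval: "continuous_on UNIV (\<lambda>f::C01. f s)"
proof -
  have "dist (f s) (g s) \<le> dist f g" for f g :: C01 by (rule dist_bounded)
  then show ?thesis unfolding continuous_on_iff by (metis order_le_less_trans)
qed

lemma continuous_polynomial_endpoint_product:
  "continuous_polynomial (\<lambda>f::C01. f 0 * f 1)"
proof -
  let ?p = "\<lambda>i::nat. if i = 0 then 0 else 1 :: unit_interval"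
  have "homogeneous_polynomial 2 (\<lambda>f::C01. f 0 * f 1)"
    unfolding homogeneous_polynomial_def
    by (intro exI[of _ "\<lambda>x::nat \<Rightarrow> C01. \<Prod>i<2. x i (?p i)"] conjI multilinear_form_prod) (simp add: numeral_2_eq_2)
  then show ?thesis
    unfolding continuous_polynomial_def
    by (intro conjI homogeneous_imp_polynomial continuous_intros continuous_on_eval)
qed

lemma continuous_polynomial_endpoint_power_sum:
  "continuous_polynomial (\<lambda>f::C01. f 0 ^ n + f 1 ^ n)"
proof -
  have "homogeneous_polynomial n (\<lambda>f::C01. f 0 ^ n + f 1 ^ n)"
    unfolding homogeneous_polynomial_def
    by (intro exI[of _ "\<lambda>x::nat \<Rightarrow> C01. (\<Prod>i<n. x i 0) + (\<Prod>i<n. x i 1)"] conjI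
        multilinear_form_add multilinear_form_prod) simp
  then show ?thesis
    unfolding continuous_polynomial_def
    by (intro conjI homogeneous_imp_polynomial continuous_intros continuous_on_eval)
qed

section \<open>Separation from the closed unit ball\<close>

lemma separatesI:
  assumes "\<And>f. f \<in> B \<Longrightarrow> cmod (P f) \<le> M" "M < cmod (P g)"
  shows "separates P g B"
proof -
  have "(SUP f\<in>B. ereal (cmod (P f))) \<le> ereal M" by (rule SUP_least) (simp add: assms)
  then show ?thesis unfolding separates_def using assms(2)
    by (metis order_le_less_trans less_ereal.simps(1))
qed

text \<open>In a power sum, two large endpoint values might cancel for a given \<open>n\<close>. If
  the product has modulus at most 1, one value lies in the unit disc and cannot cancel the power of
  the other.\<close>

lemma separating_polynomial_exists:
  fixes g :: C01
  assumes "max (cmod (g 0)) (cmod (g 1)) > 1"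
  shows "\<exists>P. continuous_polynomial P \<and> H_invariant P \<and> separates P g (cball 0 1)"
proof -
  have eval: "cmod (f s) \<le> 1" if "f \<in> cball 0 1" for f :: C01 and s
    using that norm_bounded[of f s] by simp
  show ?thesis
  proof (cases "cmod (g 0 * g 1) > 1")
    case True
    have "separates (\<lambda>f::C01. f 0 * f 1) g (cball 0 1)"
    proof (rule separatesI)
      show "cmod (f 0 * f 1) \<le> 1" if "f \<in> cball 0 1" for f :: C01
        by (simp only: norm_mult mult_le_one eval[OF that] norm_ge_zero)
    qed (use True in simp)
    moreover have "H_invariant (\<lambda>f::C01. f 0 * f 1)"
      by (rule H_invariant_symmetric) (rule mult.commute)
    ultimately show ?thesis using continuous_polynomial_endpoint_product by blast
  next
    case False
    define r where "r = max (cmod (g 0)) (cmod (g 1))"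
    have le: "cmod (g 0) * cmod (g 1) \<le> 1" using False by (simp add: norm_mult)
    have r: "r > 1" using assms by (simp add: r_def)
    have min: "min (cmod (g 0)) (cmod (g 1)) \<le> 1"
    proof (rule ccontr)
      assume "\<not> ?thesis"
      then have "1 < cmod (g 0) * cmod (g 1)" by (intro less_1_mult) auto
      with le show False by simp
    qed
    \<comment> \<open>The power sum is at most 2 on the ball and at least \<open>r ^ n - 1\<close>
      at \<open>g\<close>.\<close>
    obtain n where n: "r ^ n > 3" using real_arch_pow[OF r] by blast
    have diff: "2 < cmod (x ^ n + y ^ n)" if "cmod x = r" "cmod y \<le> 1" for x y
    proof -
      have "cmod (x ^ n) = r ^ n" "cmod (y ^ n) \<le> 1" using that by (simp_all add: norm_power power_le_one)
      then show ?thesis using n norm_diff_ineq[of "x ^ n" "y ^ n"] by linarith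
    qed
    have "2 < cmod (g 0 ^ n + g 1 ^ n)"
    proof (cases "cmod (g 0) \<le> cmod (g 1)")
      case True
      then show ?thesis using diff[of "g 1" "g 0"] min by (simp add: r_def add.commute)
    next
      case False
      then show ?thesis using diff[of "g 0" "g 1"] min by (simp add: r_def)
    qed
    moreover have "cmod (f 0 ^ n + f 1 ^ n) \<le> 2" if "f \<in> cball 0 1" for f :: C01
    proof -
      have "cmod (f s ^ n) \<le> 1" for s
        using eval[OF that] by (simp add: norm_power power_le_one)
      then show ?thesis using norm_triangle_mono[of "f 0 ^ n" 1 "f 1 ^ n" 1] by simp
    qed
    ultimately have "separates (\<lambda>f::C01. f 0 ^ n + f 1 ^ n) g (cball 0 1)" by (intro separatesI)
    moreover have "H_invariant (\<lambda>f::C01. f 0 ^ n + f 1 ^ n)"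
      by (rule H_invariant_symmetric[of "\<lambda>x y. x ^ n + y ^ n"]) (rule add.commute)
    ultimately show ?thesis using continuous_polynomial_endpoint_power_sum by blast
  qed
qed

theorem theorem4p10:
  fixes g :: C01
  assumes "g \<notin> cball 0 1"
  shows "(\<exists>P. continuous_polynomial P \<and> H_invariant P \<and> separates P g (cball 0 1)) \<longleftrightarrow>
           max (cmod (g 0)) (cmod (g 1)) > 1"
proof
  assume "\<exists>P. continuous_polynomial P \<and> H_invariant P \<and> separates P g (cball 0 1)"
  then obtain P where P: "continuous_polynomial P" "H_invariant P" "separates P g (cball 0 1)"
    by blast
  show "max (cmod (g 0)) (cmod (g 1)) > 1"
  proof (rule ccontr)
    assume "\<not> ?thesis"
    then have le: "cmod (g 0) \<le> 1" "cmod (g 1) \<le> 1" by auto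
    \<comment> \<open>By convexity of the disc the segment stays in the ball, and it shares its
      endpoints with \<open>g\<close>.\<close>
    let ?l = "\<lambda>x. of_real (1 - x) * g 0 + of_real x * g 1"
    have cont: "continuous_on {0..1} ?l" by (intro continuous_intros)
    have "norm (of_fun ?l) \<le> 1"
    proof (rule norm_bound)
      fix s
      have x: "0 \<le> coord s" "coord s \<le> 1" using coord[of s] by auto
      have "cmod (?l (coord s)) \<le> (1 - coord s) * cmod (g 0) + coord s * cmod (g 1)"
        using x by (intro norm_triangle_le) (simp add: norm_mult del: of_real_diff)
      also have "\<dots> \<le> (1 - coord s) * 1 + coord s * 1"
        using x le by (intro add_mono mult_left_mono) auto
      finally have "cmod (?l (coord s)) \<le> 1" by simp
      then show "cmod (of_fun ?l s) \<le> 1" by (simp only: apply_of_fun[OF cont])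
    qed
    then have "of_fun ?l \<in> cball 0 1" by simp
    then have "ereal (cmod (P (of_fun ?l))) \<le> (SUP f\<in>cball 0 1. ereal (cmod (P f)))"
      by (rule SUP_upper)
    also have "\<dots> < ereal (cmod (P g))" using P(3) unfolding separates_def .
    finally have "ereal (cmod (P (of_fun ?l))) < ereal (cmod (P g))" .
    moreover have "P (of_fun ?l) = P g"
      by (rule H_invariant_depends_on_endpoints[OF P(1,2)])
         (simp_all add: apply_of_fun[OF cont] zero_unit_interval.rep_eq one_unit_interval.rep_eq
           del: of_real_diff)
    ultimately show False by simp
  qed
qed (rule separating_polynomial_exists)

end
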